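(* Let $S$ be a set of edges with routing probability $r(e) \in (0,1]$ for each $e \in S$, where $\sum_{e \in S} r(e) = 1$, and let $T$ be the alias tree constructed on $S$ (from $r$ and a degree threshold $d$). Then the selection procedure on $T$ selects an element $e \in S$ with probability equal to $r(e)$.
   Context: **The alias method.** Input: a set $S$ of elements and routing probabilities $r(e)$, $e\in S$, with $\sum_{e\in S} r(e)=1$. Output: a switch probability $p(e) \in [0,1]$ and an alias $a(e) \in S$ for each $e \in S$, computed as follows. Initialize $p(e) = |S|\cdot r(e)$ and $a(e) = e$ for all $e\in S$, and let $S^l = \{e \in S : p(e) > 1\}$, $S^s = \{e \in S : p(e) < 1\}$. While $S^l$ is not empty: select any $x \in S^s$ and $y \in S^l$; set $a(x) = y$ and remove $x$ from $S^s$; decrease $p(y)$ by $1-p(x)$; if now $p(y) \le 1$, remove $y$ from $S^l$, and if moreover $p(y) < 1$, add $y$ to $S^s$. Return $p(e)$ and $a(e)$ for all $e\in S$. **Alias tree.** Given $S$, $r$ and a degree threshold $d$ (a user-defined parameter), the alias tree $T(S)$ is constructed recursively. - If $|S| \le d$, then $T(S)$ is the output of the alias method on $S$ with $r$, forming a single node of the tree. - Otherwise, let $b = \lceil |S|/d \rceil$ and split $S$ at random into $b$ disjoint subsets with union $S$, each of size not bigger than $d$; write $\mathcal{S} = \{S_1,\dots,S_b\}$. Put $w'(S_i) = \sum_{e\in S_i} r(e)$, $r'(S_i) = w'(S_i)/\sum_{S'\in\mathcal{S}} w'(S')$, and, for $e \in S_i$, $r_i(e) = r(e)/\sum_{e'\in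 S_i} r(e')$. For each $i$, compute by the alias method on $S_i$ with $r_i$ the node $f(S_i)$, which is made the child of $\mathcal{S}$ attached to the item $S_i$. Then $T(S)$ is built by recursively constructing the alias tree on the set of items $\mathcal{S}$ with routing probability $r'$ and threshold $d$. Original elements $e$ of $S$ have no children ($f(e)$ is empty). **Selection procedure.** Start at the root of the tree. At a node with item set $X$, switch probabilities $p$ and aliases $a$, choose an item $x \in X$ with probability $1/|X|$ and generate a random number $q\in[0,1]$ (uniformly). If $q \le p(x)$, select $x$; otherwise select $a(x)$. If the selected item $y$ has children, i.e. $f(y)$ is not empty, recursively repeat the procedure on the items in $f(y)$; otherwise return $y$. *)

theory Defs
  imports "HOL-Probability.Probability" "HOL-Library.FSet" "HOL-Library.Disjoint_Sets"
begin

text \<open>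
  The items handled at some level of the construction are elements of the original set, blocks of
  elements, blocks of blocks, and so on.
\<close>

datatype 'a item = Elem 'a | Block "'a item fset"

datatype 'b node = Node (items: "'b set") (switch_prob: "'b \<Rightarrow> real") (alias_of: "'b \<Rightarrow> 'b")


text \<open>
  The alias method. A state \<open>(p, a, L, M)\<close> consists of the switch probabilities, the aliases, and
  the sets $S^l$ and $S^s$. The choice of \<open>x\<close> and \<open>y\<close> is arbitrary, so the method is a relation.
  Values of \<open>p\<close> and \<open>a\<close> outside the item set carry no meaning.
\<close>

type_synonym 'b alias_state = "('b \<Rightarrow> real) \<times> ('b \<Rightarrow> 'b) \<times> 'b set \<times> 'b set"

definition alias_init :: "'b set \<Rightarrow> ('b \<Rightarrow> real) \<Rightarrow> 'b alias_state" where
  "alias_init X r = (let p = (\<lambda>e. real (card X) * r e) in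
     (p, (\<lambda>e. e), {e \<in> X. p e > 1}, {e \<in> X. p e < 1}))"

inductive alias_step :: "'b alias_state \<Rightarrow> 'b alias_state \<Rightarrow> bool" where
  "\<lbrakk>x \<in> M; y \<in> L; p' = p(y := p y - (1 - p x));
    L' = (if p' y \<le> 1 then L - {y} else L);
    M' = (if p' y < 1 then insert y (M - {x}) else M - {x})\<rbrakk>
   \<Longrightarrow> alias_step (p, a, L, M) (p', a(x := y), L', M')"

definition alias_method :: "'b set \<Rightarrow> ('b \<Rightarrow> real) \<Rightarrow> 'b node \<Rightarrow> bool" where
  "alias_method X r N \<longleftrightarrow> (\<exists>p a M. alias_step\<^sup>*\<^sup>* (alias_init X r) (p, a, {}, M) \<and> N = Node X p a)"


text \<open>
  A tree is given by its root and the partial map $f$ sending an item to the child node attached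
  to it. The splitting and the alias method are not deterministic, so the construction is again a
  relation: it relates the input to every tree that can be produced. Since \<open>partition_on\<close> excludes
  empty blocks, the normalised probabilities inside a block are well defined. If \<open>d = 1\<close>
  and there are several items, the number of items does not decrease and the recursion never
  reaches its base case; if \<open>d = 0\<close>, there is no admissible splitting. In these cases no tree is
  related to the input.
\<close>

type_synonym 'a alias_tree = "'a item node \<times> ('a item \<rightharpoonup> 'a item node)"

definition block_weight :: "('b \<Rightarrow> real) \<Rightarrow> 'b fset \<Rightarrow> real" where
  "block_weight r B = (\<Sum>e\<in>fset B. r e)"

definition inner_prob :: "('b \<Rightarrow> real) \<Rightarrow> 'b fset \<Rightarrow> 'b \<Rightarrow> real" where
  "inner_prob r B e = r e / (\<Sum>e'\<in>fset B. r e')"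

fun outer_prob :: "('a item \<Rightarrow> real) \<Rightarrow> 'a item fset set \<Rightarrow> 'a item \<Rightarrow> real" where
  "outer_prob r P (Block B) = block_weight r B / (\<Sum>B'\<in>P. block_weight r B')"
| "outer_prob r P (Elem e) = 0"

inductive alias_tree ::
  "nat \<Rightarrow> 'a item set \<Rightarrow> ('a item \<Rightarrow> real) \<Rightarrow> 'a alias_tree \<Rightarrow> bool" for d where
  single:
    "\<lbrakk>finite X; card X \<le> d; alias_method X r N\<rbrakk> \<Longrightarrow> alias_tree d X r (N, Map.empty)"
| split:
    "\<lbrakk>finite X; d < card X;
      partition_on X (fset ` P); card P = nat \<lceil>real (card X) / real d\<rceil>;
      \<And>B. B \<in> P \<Longrightarrow> card (fset B) \<le> d;
      \<And>B. B \<in> P \<Longrightarrow> alias_method (fset B) (inner_prob r B) (c (Block B));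
      alias_tree d (Block ` P) (outer_prob r P) (N, f)\<rbrakk>
     \<Longrightarrow> alias_tree d X r (N, \<lambda>y. if y \<in> Block ` P then Some (c y) else f y)"

fun elem_prob :: "('a \<Rightarrow> real) \<Rightarrow> 'a item \<Rightarrow> real" where
  "elem_prob r (Elem e) = r e"
| "elem_prob r (Block B) = 0"

definition is_alias_tree :: "nat \<Rightarrow> 'a set \<Rightarrow> ('a \<Rightarrow> real) \<Rightarrow> 'a alias_tree \<Rightarrow> bool" where
  "is_alias_tree d S r T \<longleftrightarrow> alias_tree d (Elem ` S) (elem_prob r) T"


text \<open>
  The law of the item selected from \<open>x\<close> with a uniform \<open>q\<close>. The lemma shows that the measure is
  discrete, so that \<open>Abs_pmf\<close> is applied to a legitimate argument.
\<close>

definition switch_pmf :: "('b \<Rightarrow> real) \<Rightarrow> ('b \<Rightarrow> 'b) \<Rightarrow> 'b \<Rightarrow> 'b pmf" where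
  "switch_pmf p a x = Abs_pmf (distr (uniform_measure lborel {0..1}) (count_space UNIV)
     (\<lambda>q. if q \<le> p x then x else a x))"

lemma measure_pmf_switch_pmf:
  "measure_pmf (switch_pmf p a x) = distr (uniform_measure lborel {0..1}) (count_space UNIV)
     (\<lambda>q. if q \<le> p x then x else a x)"
proof -
  define U where "U = uniform_measure lborel {0..1::real}"
  define g where "g = (\<lambda>q. if q \<le> p x then x else a x)"
  define D where "D = distr U (count_space UNIV) g"
  have U: "prob_space U"
    unfolding U_def by (rule prob_space_uniform_measure) simp_all
  have sU: "sets U = sets borel"
    by (simp add: U_def)
  have "g \<in> measurable borel (count_space UNIV)"
    unfolding g_def by measurable
  then have g: "g \<in> measurable U (count_space UNIV)"
    using measurable_cong_sets[OF sU refl] by blast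
  interpret D: prob_space D
    unfolding D_def using U g by (rule prob_space.prob_space_distr)
  have sD: "sets D = UNIV"
    by (simp add: D_def)
  have "AE y in D. y \<in> {x, a x}"
    unfolding D_def by (subst AE_distr_iff[OF g]) (auto simp: g_def)
  moreover have "AE y in D. y \<notin> {z \<in> {x, a x}. measure D {z} = 0}"
  proof (rule AE_not_in, rule null_setsI)
    have "emeasure D {z \<in> {x, a x}. measure D {z} = 0}
        = (\<Sum>z\<in>{z \<in> {x, a x}. measure D {z} = 0}. emeasure D {z})"
      by (rule emeasure_eq_sum_singleton) (simp_all add: sD)
    also have "\<dots> = 0"
      by (rule sum.neutral) (simp add: D.emeasure_eq_measure)
    finally show "emeasure D {z \<in> {x, a x}. measure D {z} = 0} = 0" .
  qed (simp add: sD)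
  ultimately have "AE y in D. measure D {y} \<noteq> 0"
    by eventually_elim auto
  with D.prob_space_axioms sD have "measure_pmf (Abs_pmf D) = D"
    by (intro Abs_pmf_inverse) auto
  then show ?thesis
    by (simp add: switch_pmf_def D_def U_def g_def)
qed

definition node_pmf :: "'b node \<Rightarrow> 'b pmf" where
  "node_pmf N = bind_pmf (pmf_of_set (items N)) (switch_pmf (switch_prob N) (alias_of N))"

text \<open>
  \<open>spmf\<close> is only used to write the recursion without a termination argument: possible
  non-termination would show up as missing mass.
\<close>

partial_function (spmf) select_from ::
  "('a item \<rightharpoonup> 'a item node) \<Rightarrow> 'a item node \<Rightarrow> 'a item spmf" where
  "select_from f N = bind_spmf (spmf_of_pmf (node_pmf N))
     (\<lambda>y. case f y of None \<Rightarrow> return_spmf y | Some N' \<Rightarrow> select_from f N')"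

definition selection :: "'a alias_tree \<Rightarrow> 'a item spmf" where
  "selection T = select_from (snd T) (fst T)"

end

theory Submission
  imports Defs
begin

text \<open>
  The alias method preserves, for every item \<open>e\<close>, the quantity that consists of \<open>p e\<close> and of the
  parts \<open>1 - p x\<close> of all items \<open>x\<close> already redirected to \<open>e\<close>; it equals \<open>|X| r e\<close> initially. When no
  item has \<open>p > 1\<close>, summing over all items shows that every item that was not redirected has
  \<open>p = 1\<close>, so the quantity divided by \<open>|X|\<close> is the probability that the node selects \<open>e\<close>. In the tree,
  an element of a block is selected with the weight of the block times its
  normalised weight inside the block, and the normalisation cancels.
\<close>

section \<open>The alias method at a single node\<close>

text \<open>The values of \<open>q\<close> that lead to \<open>e\<close> form a union of at most two
  disjoint intervals, of lengths \<open>p x\<close> and \<open>1 - p x\<close>. If \<open>x\<close>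
  and \<open>a x\<close> are both \<open>e\<close>, the two terms add up to 1.\<close>

lemma pmf_switch_pmf:
  assumes "0 \<le> p x" "p x \<le> 1"
  shows "pmf (switch_pmf p a x) e = p x * of_bool (x = e) + (1 - p x) * of_bool (a x = e)"
proof -
  define A where "A = {q \<in> {0..1}. (if q \<le> p x then x else a x) = e}"
  have "pmf (switch_pmf p a x) e = measure (uniform_measure lborel {0..1})
      {q. (if q \<le> p x then x else a x) = e}"
    unfolding pmf.rep_eq measure_pmf_switch_pmf
    by (subst measure_distr) (auto simp: vimage_def)
  also have "\<dots> = measure lborel A"
    unfolding measure_uniform_measure
    by (subst measure_uniform_measure) (auto simp: A_def Int_def conj_commute)
  also have "A = (if x = e then {0..p x} else {}) \<union> (if a x = e then {p x<..1} else {})"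
    using assms by (auto simp: A_def)
  also have "measure lborel \<dots> = p x * of_bool (x = e) + (1 - p x) * of_bool (a x = e)"
    using assms by (auto simp: ivl_disj_un)
  finally show ?thesis .
qed

text \<open>The alias serves as the mark of redirection: \<open>a x = x\<close> holds initially, and
  a step never assigns an item to itself because \<open>p x < 1 < p y\<close>.\<close>

definition redirected :: "'b set \<Rightarrow> ('b \<Rightarrow> real) \<Rightarrow> ('b \<Rightarrow> 'b) \<Rightarrow> 'b \<Rightarrow> real" where
  "redirected X p a e = (\<Sum>x\<in>X. if a x \<noteq> x \<and> a x = e then 1 - p x else 0)"

text \<open>Both work sets can be read off from \<open>p\<close> and \<open>a\<close>: an item with
  \<open>p e < 1\<close> has left \<open>M\<close> exactly when its alias is another item.
  Redirected items keep \<open>p e < 1\<close>, so they never serve as \<open>y\<close> again and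
  their \<open>p\<close> stays frozen.\<close>

fun alias_inv :: "'b set \<Rightarrow> ('b \<Rightarrow> real) \<Rightarrow> 'b alias_state \<Rightarrow> bool" where
  "alias_inv X r (p, a, L, M) \<longleftrightarrow>
     L = {e \<in> X. p e > 1} \<and> M = {e \<in> X. p e < 1 \<and> a e = e} \<and>
     (\<forall>e\<in>X. 0 \<le> p e \<and> a e \<in> X \<and> (a e \<noteq> e \<longrightarrow> p e < 1) \<and>
       real (card X) * r e = p e + redirected X p a e)"

lemma alias_inv_init:
  assumes "\<And>e. e \<in> X \<Longrightarrow> 0 \<le> r e"
  shows "alias_inv X r (alias_init X r)"
  using assms by (auto simp: alias_init_def Let_def redirected_def)

text \<open>What \<open>p y\<close> loses is what \<open>redirected\<close> gains at
  \<open>y\<close>, and \<open>p y\<close> stays nonnegative because it exceeds 1 before at most 1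
  is taken away.\<close>

lemma alias_inv_step:
  assumes "finite X" "alias_step s s'" "alias_inv X r s"
  shows "alias_inv X r s'"
  using assms(2,3)
proof (induction rule: alias_step.induct)
  case (1 x M y L p' p L' M' a)
  have x: "x \<in> X" "p x < 1" "a x = x" "0 \<le> p x" and y: "y \<in> X" "p y > 1" "a y = y"
    using 1 by auto
  then have "x \<noteq> y" by auto
  \<comment> \<open>Only the summand of \<open>x\<close> changes: the new value at \<open>y\<close>
    does not enter the sum, since \<open>y\<close> is its own alias.\<close>
  have red: "redirected X p' (a(x := y)) e = redirected X p a e + (if e = y then 1 - p x else 0)" for e
  proof -
    have "redirected X p' (a(x := y)) e =
        (\<Sum>z\<in>X. (if a z \<noteq> z \<and> a z = e then 1 - p z else 0) +
          (if x = z then (if e = y then 1 - p x else 0) else 0))"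
      unfolding redirected_def using x y \<open>x \<noteq> y\<close> 1(3)
      by (intro sum.cong) auto
    then show ?thesis
      using x \<open>finite X\<close> by (simp add: sum.distrib redirected_def)
  qed
  have p': "p' z = (if z = y then p y - (1 - p x) else p z)" for z
    using 1(3) by simp
  have "L' = {e \<in> X. p' e > 1}"
    using 1 y by (auto simp: p')
  moreover have "M' = {e \<in> X. p' e < 1 \<and> (a(x := y)) e = e}"
    using 1 x y \<open>x \<noteq> y\<close> by (auto simp: p')
  moreover have "\<forall>e\<in>X. 0 \<le> p' e \<and> (a(x := y)) e \<in> X \<and> ((a(x := y)) e \<noteq> e \<longrightarrow> p' e < 1) \<and>
       real (card X) * r e = p' e + redirected X p' (a(x := y)) e"
    unfolding red using 1 x y \<open>x \<noteq> y\<close> by (auto simp: p')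
  ultimately show ?case
    by simp
qed

lemma alias_inv_steps:
  assumes "finite X" "alias_step\<^sup>*\<^sup>* s s'" "alias_inv X r s"
  shows "alias_inv X r s'"
  using assms(2,3) by (induction rule: rtranclp_induct) (blast intro: alias_inv_step[OF assms(1)])+

lemma pmf_node_pmf:
  assumes "finite X" and r: "\<And>e. e \<in> X \<Longrightarrow> 0 \<le> r e" and sum: "(\<Sum>e\<in>X. r e) = 1"
    and "alias_method X r N"
  shows "pmf (node_pmf N) e = (if e \<in> X then r e else 0)"
proof -
  obtain p a M where "alias_step\<^sup>*\<^sup>* (alias_init X r) (p, a, {}, M)" and N: "N = Node X p a"
    using assms(4) by (auto simp: alias_method_def)
  from this(1) have "alias_inv X r (p, a, {}, M)"
    by (rule alias_inv_steps[OF assms(1)]) (rule alias_inv_init[OF r])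
  then have inv: "0 \<le> p x" "p x \<le> 1" "a x \<in> X" "real (card X) * r x = p x + redirected X p a x"
    if "x \<in> X" for x
    using that unfolding alias_inv.simps by (blast, fastforce simp: not_less, blast, blast)
  have "X \<noteq> {}"
    using sum by auto
  have "real (card X) = (\<Sum>e\<in>X. real (card X) * r e)"
    using sum by (simp flip: sum_distrib_left)
  also have "\<dots> = (\<Sum>e\<in>X. p e) + (\<Sum>e\<in>X. redirected X p a e)"
    using inv(4) by (simp add: sum.distrib)
  also have "(\<Sum>e\<in>X. redirected X p a e) = (\<Sum>x\<in>X. \<Sum>e\<in>X. if a x \<noteq> x \<and> a x = e then 1 - p x else 0)"
    unfolding redirected_def by (rule sum.swap)
  also have "\<dots> = (\<Sum>x\<in>X. if a x \<noteq> x then 1 - p x else 0)"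
  proof (intro sum.cong refl)
    fix x assume "x \<in> X"
    then show "(\<Sum>e\<in>X. if a x \<noteq> x \<and> a x = e then 1 - p x else 0) = (if a x \<noteq> x then 1 - p x else 0)"
      using inv(3) \<open>finite X\<close> by (cases "a x = x") simp_all
  qed
  \<comment> \<open>Subtraction leaves the deficits \<open>1 - p x\<close> of the items without a
    foreign alias. They are nonnegative because no item has \<open>p > 1\<close> at the end, so each
    of them vanishes.\<close>
  finally have "(\<Sum>x\<in>X. if a x \<noteq> x then 0 else 1 - p x) = 0"
  proof -
    assume *: "real (card X) = (\<Sum>e\<in>X. p e) + (\<Sum>x\<in>X. if a x \<noteq> x then 1 - p x else 0)"
    have "(\<Sum>x\<in>X. if a x \<noteq> x then 0 else 1 - p x) =
        (\<Sum>x\<in>X. 1 - p x - (if a x \<noteq> x then 1 - p x else 0))"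
      by (intro sum.cong) auto
    then show ?thesis
      using * by (simp add: sum_subtractf)
  qed
  then have full: "p x = 1" if "x \<in> X" "a x = x" for x
    using that inv(2) \<open>finite X\<close>
    by (subst (asm) sum_nonneg_eq_0_iff) (auto split: if_splits)
  have "pmf (node_pmf N) e = (\<Sum>x\<in>X. p x * of_bool (x = e) + (1 - p x) * of_bool (a x = e)) / card X"
    using \<open>X \<noteq> {}\<close> \<open>finite X\<close> inv
    by (simp add: node_pmf_def N pmf_bind_pmf_of_set pmf_switch_pmf)
  \<comment> \<open>The guard \<open>a x \<noteq> x\<close> may be inserted because a self-aliased
    item has \<open>1 - p x = 0\<close>.\<close>
  also have "(\<Sum>x\<in>X. p x * of_bool (x = e) + (1 - p x) * of_bool (a x = e)) =
      (\<Sum>x\<in>X. (if x = e then p x else 0) + (if a x \<noteq> x \<and> a x = e then 1 - p x else 0))"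
    using full by (intro sum.cong) auto
  also have "\<dots> = (if e \<in> X then p e else 0) + redirected X p a e"
    using \<open>finite X\<close> by (simp add: sum.distrib redirected_def)
  also have "\<dots> = (if e \<in> X then card X * r e else 0)"
    using inv(3,4) by (auto simp: redirected_def intro!: sum.neutral)
  finally show ?thesis
    using \<open>X \<noteq> {}\<close> \<open>finite X\<close> by auto
qed

section \<open>Nesting depth, which tells the stages of the construction apart\<close>

primrec depth :: "'a item \<Rightarrow> nat" where
  "depth (Elem e) = 0"
| "depth (Block B) = Suc (Max (fset (fimage depth B)))"

lemma depth_Block:
  assumes "\<And>x. x \<in> fset B \<Longrightarrow> depth x = n" "fset B \<noteq> {}"
  shows "depth (Block B) = Suc n"
proof -
  have "depth ` fset B = {n}"
    using assms by auto
  then show ?thesis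
    by simp
qed

lemma depth_partition_Block:
  assumes "partition_on X (fset ` P)" "\<And>x. x \<in> X \<Longrightarrow> depth x = n" "B \<in> P"
  shows "depth (Block B) = Suc n"
  using assms by (intro depth_Block) (auto dest: partition_onD1 partition_onD3)

text \<open>Children are attached to blocks of items from \<open>X\<close> or to blocks nested more
  deeply still. Hence the keys of different stages cannot collide, and the items of \<open>X\<close>
  have no children in \<open>T\<close>.\<close>

lemma alias_tree_depth:
  assumes "alias_tree d X r T" "\<And>x. x \<in> X \<Longrightarrow> depth x = n" "y \<in> dom (snd T)"
  shows "n < depth y"
  using assms
proof (induction arbitrary: n rule: alias_tree.induct)
  case (split X P r c N f)
  have D: "depth (Block B) = Suc n" if "B \<in> P" for B
    using depth_partition_Block[OF split.hyps(3) split.prems(1) that] .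
  show ?case
  proof (cases "y \<in> Block ` P")
    case False
    then have "Suc n < depth y"
      using split.prems(2) D by (intro split.IH) (auto simp: dom_def)
    then show ?thesis
      by simp
  qed (use D in force)
qed simp

section \<open>Selection in the whole tree\<close>

lemma finite_partition_fset:
  assumes "finite X" "partition_on X (fset ` P)"
  shows "finite P"
  using finite_elements[OF assms] by (rule finite_imageD) (simp add: inj_on_def fset_inject)

lemma sum_block_weight:
  assumes "finite X" "partition_on X (fset ` P)"
  shows "(\<Sum>B\<in>P. block_weight r B) = (\<Sum>x\<in>X. r x)"
proof -
  have "(\<Sum>x\<in>X. r x) = (\<Sum>A\<in>fset ` P. \<Sum>x\<in>A. r x)"
    using assms
    by (subst partition_onD1[OF assms(2)], subst sum.Union_disjoint)
       (use partition_onD2[OF assms(2)] in \<open>auto simp: disjoint_def\<close>)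
  also have "\<dots> = (\<Sum>B\<in>P. block_weight r B)"
    by (subst sum.reindex) (auto simp: inj_on_def fset_inject block_weight_def)
  finally show ?thesis
    by simp
qed

text \<open>
  The map \<open>g\<close> is allowed to extend \<open>f\<close> because the selection in a subtree runs with the child map of
  the whole tree; the children of the items in \<open>X\<close> itself are only present there.
\<close>

lemma select_from_alias_tree:
  assumes "alias_tree d X r T" "\<And>x. x \<in> X \<Longrightarrow> depth x = n"
    and "\<And>x. x \<in> X \<Longrightarrow> 0 < r x" "(\<Sum>x\<in>X. r x) = 1" "snd T \<subseteq>\<^sub>m g"
  shows "\<exists>Q. (\<forall>x. pmf Q x = (if x \<in> X then r x else 0)) \<and>
    select_from g (fst T) =
      bind_pmf Q (\<lambda>y. case g y of None \<Rightarrow> return_spmf y | Some N' \<Rightarrow> select_from g N')"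
  using assms
proof (induction arbitrary: n rule: alias_tree.induct)
  case (single X r N)
  show ?case
  proof (intro exI conjI allI)
    show "pmf (node_pmf N) x = (if x \<in> X then r x else 0)" for x
      using single by (intro pmf_node_pmf) (auto intro: less_imp_le)
    show "select_from g (fst (N, Map.empty)) = bind_pmf (node_pmf N)
        (\<lambda>y. case g y of None \<Rightarrow> return_spmf y | Some N' \<Rightarrow> select_from g N')"
      by (simp add: select_from.simps[of g N])
  qed
next
  case (split X P r c N f)
  note part = split.hyps(3)
  have finP: "finite P"
    using finite_partition_fset split.hyps(1) part .
  have sub: "fset B \<subseteq> X" and ne: "fset B \<noteq> {}" if "B \<in> P" for B
    using that part by (auto dest: partition_onD1 partition_onD3)
  have D: "depth (Block B) = Suc n" if "B \<in> P" for B
    using depth_partition_Block[OF part split.prems(1) that] .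
  have W: "0 < block_weight r B" if "B \<in> P" for B
    unfolding block_weight_def using sub[OF that] ne[OF that] split.prems(2)
    by (intro sum_pos) auto
  have total: "(\<Sum>B\<in>P. block_weight r B) = 1"
    using sum_block_weight[OF split.hyps(1) part] split.prems(3) by simp
  have gB: "g (Block B) = Some (c (Block B))" if "B \<in> P" for B
    using split.prems(4) that by (auto simp: map_le_def dom_def)
  \<comment> \<open>The new keys have depth \<open>Suc n\<close> and those of \<open>f\<close> are
    deeper, so the case distinction in the child map overrides no entry of \<open>f\<close>.\<close>
  have "f \<subseteq>\<^sub>m g"
    unfolding map_le_def
  proof
    fix y assume y: "y \<in> dom f"
    then have "y \<notin> Block ` P"
      using alias_tree_depth[OF split.hyps(7), of "Suc n" y] D by fastforce
    with y split.prems(4) show "f y = g y"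
      by (force simp: map_le_def dom_def)
  qed
  moreover have "(\<Sum>x\<in>Block ` P. outer_prob r P x) = 1"
    by (subst sum.reindex) (simp_all add: inj_on_def total)
  moreover have "0 < outer_prob r P x" if "x \<in> Block ` P" for x
    using that W by (auto simp: total)
  ultimately obtain Q where Q: "\<And>x. pmf Q x = (if x \<in> Block ` P then outer_prob r P x else 0)"
    and sel: "select_from g N =
      bind_pmf Q (\<lambda>y. case g y of None \<Rightarrow> return_spmf y | Some N' \<Rightarrow> select_from g N')"
    using split.IH[of "Suc n"] D by fastforce
  have setQ: "set_pmf Q \<subseteq> Block ` P"
    by (auto simp: set_pmf_iff Q split: if_splits)
  have inner: "pmf (node_pmf (c (Block B))) x = (if x \<in> fset B then inner_prob r B x else 0)"
    if "B \<in> P" for B x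
  proof (rule pmf_node_pmf)
    show "0 \<le> inner_prob r B e" if "e \<in> fset B" for e
      using W[OF \<open>B \<in> P\<close>] split.prems(2)[of e] sub[OF \<open>B \<in> P\<close>] that
      by (auto simp: inner_prob_def block_weight_def)
    show "(\<Sum>e\<in>fset B. inner_prob r B e) = 1"
      using W[OF \<open>B \<in> P\<close>]
      by (simp add: inner_prob_def block_weight_def flip: sum_divide_distrib)
  qed (use that split.hyps in auto)
  show ?case
  \<comment> \<open>The witness draws a block from the law \<open>Q\<close> of the upper tree, then
    an item from the node attached to that block.\<close>
  proof (intro exI conjI allI)
    fix x
    have "pmf (bind_pmf Q (\<lambda>y. node_pmf (c y))) x =
        (\<Sum>y\<in>Block ` P. pmf (node_pmf (c y)) x * pmf Q y)"
      unfolding pmf_bind using setQ finP by (subst integral_measure_pmf_real) auto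
    \<comment> \<open>The block weights have total 1, so \<open>Q\<close> gives a block its weight,
      which cancels the denominator of \<open>inner_prob\<close>.\<close>
    also have "\<dots> = (\<Sum>B\<in>P. if x \<in> fset B then r x else 0)"
    proof (subst sum.reindex)
      show "(\<Sum>B\<in>P. ((\<lambda>y. pmf (node_pmf (c y)) x * pmf Q y) \<circ> Block) B) =
          (\<Sum>B\<in>P. if x \<in> fset B then r x else 0)"
      proof (intro sum.cong refl)
        fix B assume "B \<in> P"
        then show "((\<lambda>y. pmf (node_pmf (c y)) x * pmf Q y) \<circ> Block) B =
            (if x \<in> fset B then r x else 0)"
          using W[of B] inner[of B x]
          by (simp add: Q total inner_prob_def flip: block_weight_def)
      qed
    qed (simp add: inj_on_def)
    also have "\<dots> = (if x \<in> X then r x else 0)"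
    proof (cases "x \<in> X")
      case True
      then obtain B where B: "B \<in> P" "x \<in> fset B"
        using partition_onD1[OF part] by auto
      have "x \<in> fset B' \<longleftrightarrow> B' = B" if "B' \<in> P" for B'
        using B that partition_onD2[OF part]
        by (auto simp: disjoint_def fset_inject)
      then have "(\<Sum>B\<in>P. if x \<in> fset B then r x else 0) = (\<Sum>B'\<in>P. if B' = B then r x else 0)"
        by (intro sum.cong) auto
      then show ?thesis
        using True B finP by simp
    next
      case False
      then show ?thesis
        using sub by (fastforce intro!: sum.neutral)
    qed
    finally show "pmf (bind_pmf Q (\<lambda>y. node_pmf (c y))) x = (if x \<in> X then r x else 0)" .
  next
    let ?h = "\<lambda>y. case g y of None \<Rightarrow> return_spmf y | Some N' \<Rightarrow> select_from g N'"
    have "select_from g N = bind_pmf Q (\<lambda>y. bind_pmf (node_pmf (c y)) ?h)"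
      unfolding sel
    proof (intro bind_pmf_cong refl)
      fix y assume "y \<in> set_pmf Q"
      then have "g y = Some (c y)"
        using setQ gB by auto
      then show "?h y = bind_pmf (node_pmf (c y)) ?h"
        by (simp add: select_from.simps[of g "c y"])
    qed
    then show "select_from g (fst (N, \<lambda>y. if y \<in> Block ` P then Some (c y) else f y)) =
        bind_pmf (bind_pmf Q (\<lambda>y. node_pmf (c y))) ?h"
      by (simp add: bind_assoc_pmf)
  qed
qed

theorem lemma1:
  fixes S :: "'a set" and r :: "'a \<Rightarrow> real" and d :: nat and T :: "'a alias_tree"
  assumes "finite S"
    and "\<And>e. e \<in> S \<Longrightarrow> r e \<in> {0<..1}"
    and "(\<Sum>e\<in>S. r e) = 1"
    and "is_alias_tree d S r T"
  shows "\<forall>e\<in>S. spmf (selection T) (Elem e) = r e"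
proof -
  have tree: "alias_tree d (Elem ` S) (elem_prob r) T"
    using assms(4) by (simp add: is_alias_tree_def)
  have depth0: "depth x = 0" if "x \<in> Elem ` S" for x :: "'a item"
    using that by auto
  have total: "(\<Sum>x\<in>Elem ` S. elem_prob r x) = 1"
    using assms(3) by (subst sum.reindex) (auto simp: inj_on_def)
  have pos: "0 < elem_prob r x" if "x \<in> Elem ` S" for x
    using that assms(2) by auto
  obtain Q where Q: "\<And>x. pmf Q x = (if x \<in> Elem ` S then elem_prob r x else 0)"
    and sel: "selection T = bind_pmf Q (\<lambda>y. case snd T y of None \<Rightarrow> return_spmf y
      | Some N' \<Rightarrow> select_from (snd T) N')"
    using select_from_alias_tree[OF tree depth0 pos total map_le_refl, folded selection_def]
    by fast
  \<comment> \<open>Original elements have depth 0 and keys have positive depth, so the selection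
    stops here and no mass is lost.\<close>
  have "snd T y = None" if "y \<in> set_pmf Q" for y
    using that alias_tree_depth[OF tree depth0, of y]
    by (fastforce simp: set_pmf_iff Q domIff split: if_splits)
  then have "selection T = bind_pmf Q return_spmf"
    unfolding sel by (intro bind_pmf_cong) auto
  also have "\<dots> = spmf_of_pmf Q"
    by (simp flip: bind_spmf_of_pmf)
  finally show ?thesis
    by (simp add: Q)
qed

end
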